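(* Let $\lambda>0$, $\sigma_\eta>0$, $D>0$, $N\ge3$, and consider a planar circular array of $N$ antennas on the $YZ$-plane whose $n$th antenna has, relative to the reference location, distance $d_{n0}=D/2$, azimuth $\phi_{n0}=\pi/2$ and elevation $\theta_{n0}=2\pi n/N$, $n=0,\dots,N-1$. Let the source lie on the central perpendicular line of the array (the $x$-axis), at distance $d>0$ from the reference location, i.e. with spherical coordinates $(d,\theta,\phi)$ where $\theta=\pi/2$ and $\phi=0$. Let the measurement be $\mathbf{z}=h+\boldsymbol{\eta}\in\mathbb{R}^N$ with $\boldsymbol{\eta}\sim\mathcal{N}(\mathbf{0},\sigma_\eta^2\mathbf{I}_N)$, where $h$ is the differential-phase observation function (defined in the context), with the regularity convention on derivatives given in the context. For $\xi\in\{d,\theta,\phi\}$ let $\tilde J^{\mathrm D}(\xi)=\mathbb{E}_{\mathbf{z}\mid\xi}\left\{\left(\partial\ln p(\mathbf{z}\mid\xi)/\partial\xi\right)^2\right\}$ be the scalar Fisher information on $\xi$, evaluated at this source position. Then $$\tilde J^{\mathrm D}(d)=\frac{4N\pi^2}{\lambda^2\sigma_\eta^2}\cdot\frac{2+\frac{D^2}{4d^2}-2\sqrt{1+\frac{D^2}{4d^2}}}{1+\frac{D^2}{4d^2}},$$ $$\tilde J^{\mathrm D}(\theta)=\tilde J^{\mathrm D}(\phi)=\frac{N\pi^2}{2\lambda^2\sigma_\eta^2}\,\frac{D^2}{1+\frac{D^2}{4d^2}}.$$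
   Context: Geometry: a point has spherical coordinates $(\rho,\theta,\phi)$ relative to the reference location $\mathbf{r}\in\mathbb{R}^3$ if it equals $\mathbf{r}+\rho(\cos\phi\sin\theta,\sin\phi\sin\theta,\cos\theta)^{\mathsf T}$ ($\rho\ge0$ the distance, $\theta$ the elevation, $\phi$ the azimuth; the elevation of an antenna is allowed to range over $[0,2\pi)$, so the array is a circle of diameter $D$ centred at $\mathbf{r}$). The antennas are at $\mathbf{q}_n$ and the source at $\mathbf{p}$. Let $g_n=\sin\theta_{n0}\sin\theta\cos(\phi_{n0}-\phi)+\cos\theta_{n0}\cos\theta$; at the considered source position $g_n=0$ for all $n$. Observation model (as a function of general source coordinates $(d,\theta,\phi)$, with derivatives taken before setting $\theta=\pi/2,\phi=0$): $h=[h_0,\dots,h_{N-1}]^{\mathsf T}$ with $$h_n=\Delta\vartheta_n\bmod2\pi,\qquad\Delta\vartheta_n=\frac{2\pi}{\lambda}\Delta d_n,$$ $$\Delta d_n=\lVert\mathbf{p}-\mathbf{q}_n\rVert-\lVert\mathbf{p}-\mathbf{r}\rVert=d\left[\sqrt{1+\left(\frac{d_{n0}}{d}\right)^2-2\frac{d_{n0}}{d}g_n}-1\right].$$ The likelihood is $p(\mathbf{z}\mid\xi)=\mathcal{N}(\mathbf{z};h,\sigma_\eta^2\mathbf{I}_N)$, regarded as a function of the single parameter $\xi\in\{d,\theta,\phi\}$ with the other two coordinates fixed. Regularity convention: at the jump points of the modulo operation, the derivatives of $h_n$ are taken equal to the left and right derivatives; equivalently, in every derivative $h_n$ is replaced by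 $\Delta\vartheta_n$. *)

theory Defs
  imports "HOL-Probability.Probability" "HOL-Library.Real_Mod"
begin

definition spherical_point :: "real^3 \<Rightarrow> real \<Rightarrow> real \<Rightarrow> real \<Rightarrow> real^3" where
  "spherical_point r \<rho> \<theta> \<phi> = r + \<rho> *\<^sub>R vector [cos \<phi> * sin \<theta>, sin \<phi> * sin \<theta>, cos \<theta>]"

text \<open>
  The reference location is \<open>r\<close>, the antennas are \<open>q 0, \<dots>, q (N - 1)\<close>, the wavelength is \<open>wl\<close>,
  and \<open>p\<close> is the source position.
\<close>

definition path_diff :: "real^3 \<Rightarrow> (nat \<Rightarrow> real^3) \<Rightarrow> nat \<Rightarrow> real^3 \<Rightarrow> real" where
  "path_diff r q n p = norm (p - q n) - norm (p - r)"

definition phase_diff :: "real \<Rightarrow> real^3 \<Rightarrow> (nat \<Rightarrow> real^3) \<Rightarrow> nat \<Rightarrow> real^3 \<Rightarrow> real" where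
  "phase_diff wl r q n p = 2 * pi / wl * path_diff r q n p"

definition obs :: "real \<Rightarrow> real^3 \<Rightarrow> (nat \<Rightarrow> real^3) \<Rightarrow> nat \<Rightarrow> real^3 \<Rightarrow> real" where
  "obs wl r q n p = phase_diff wl r q n p rmod (2 * pi)"

text \<open>
  Vectors in \<open>\<real>\<^sup>N\<close> are functions on \<open>{..<N}\<close>; the Lebesgue measure on them is
  \<open>\<Pi>\<^sub>M n\<in>{..<N}. lborel\<close>. The following is the density of the normal distribution with mean
  \<open>\<mu>\<close> and covariance matrix \<open>\<sigma>\<^sup>2 I\<close>.
\<close>

definition iso_normal_density :: "nat \<Rightarrow> (nat \<Rightarrow> real) \<Rightarrow> real \<Rightarrow> (nat \<Rightarrow> real) \<Rightarrow> real" where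
  "iso_normal_density N \<mu> \<sigma> z =
     1 / sqrt ((2 * pi * \<sigma>\<^sup>2) ^ N) * exp (- (\<Sum>n<N. (z n - \<mu> n)\<^sup>2) / (2 * \<sigma>\<^sup>2))"

definition likelihood ::
  "nat \<Rightarrow> real \<Rightarrow> real \<Rightarrow> real^3 \<Rightarrow> (nat \<Rightarrow> real^3) \<Rightarrow> real^3 \<Rightarrow> (nat \<Rightarrow> real) \<Rightarrow> real" where
  "likelihood N wl \<sigma> r q p z = iso_normal_density N (\<lambda>n. obs wl r q n p) \<sigma> z"

definition measurement ::
  "nat \<Rightarrow> real \<Rightarrow> real^3 \<Rightarrow> (nat \<Rightarrow> real^3) \<Rightarrow> real^3 \<Rightarrow> (nat \<Rightarrow> real) \<Rightarrow> nat \<Rightarrow> real" where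
  "measurement N wl r q p e = (\<lambda>n\<in>{..<N}. obs wl r q n p + e n)"

text \<open>
  For differentiation at \<open>p\<^sub>0\<close>, \<open>h\<^sub>n\<close> is replaced by its continuous branch through \<open>h\<^sub>n(p\<^sub>0)\<close>: it has
  the value of \<open>h\<^sub>n\<close> at \<open>p\<^sub>0\<close> and the increments of the unwrapped phase, so that all its derivatives
  are those of the unwrapped phase, also where the modulo operation jumps. Substituting the
  unwrapped phase itself would also change the value of \<open>h\<^sub>n\<close>, and so the mean of the measurement.
\<close>

definition obs_branch ::
  "real \<Rightarrow> real^3 \<Rightarrow> (nat \<Rightarrow> real^3) \<Rightarrow> real^3 \<Rightarrow> nat \<Rightarrow> real^3 \<Rightarrow> real" where
  "obs_branch wl r q p\<^sub>0 n p =
     obs wl r q n p\<^sub>0 + (phase_diff wl r q n p - phase_diff wl r q n p\<^sub>0)"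

text \<open>
  The curve \<open>c\<close> maps the value of the scalar parameter to the source position, the other two
  coordinates being fixed; \<open>\<xi>\<close> is the true value of the parameter. The score is the derivative of
  the log-likelihood; see \<open>score_eq_deriv_ln_likelihood\<close> below.
\<close>

definition score ::
  "nat \<Rightarrow> real \<Rightarrow> real \<Rightarrow> real^3 \<Rightarrow> (nat \<Rightarrow> real^3) \<Rightarrow> (real \<Rightarrow> real^3) \<Rightarrow> real \<Rightarrow> (nat \<Rightarrow> real) \<Rightarrow> real"
  where
  "score N wl \<sigma> r q c \<xi> z =
     deriv (\<lambda>x. ln (iso_normal_density N (\<lambda>n. obs_branch wl r q (c \<xi>) n (c x)) \<sigma> z)) \<xi>"

definition fisher_info ::
  "'a measure \<Rightarrow> ('a \<Rightarrow> nat \<Rightarrow> real) \<Rightarrow> nat \<Rightarrow> real \<Rightarrow> real \<Rightarrow> real^3 \<Rightarrow> (nat \<Rightarrow> real^3) \<Rightarrow>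
     (real \<Rightarrow> real^3) \<Rightarrow> real \<Rightarrow> real" where
  "fisher_info M \<eta> N wl \<sigma> r q c \<xi> =
     prob_space.expectation M
       (\<lambda>\<omega>. (score N wl \<sigma> r q c \<xi> (measurement N wl r q (c \<xi>) (\<eta> \<omega>)))\<^sup>2)"

lemma obs_eq_obs_branch:
  assumes "isCont c \<xi>" and "phase_diff wl r q n (c \<xi>) / (2 * pi) \<notin> \<int>"
  shows "eventually (\<lambda>x. obs wl r q n (c x) = obs_branch wl r q (c \<xi>) n (c x)) (nhds \<xi>)"
proof -
  let ?f = "\<lambda>x. phase_diff wl r q n (c x) / (2 * pi)"
  have "isCont ?f \<xi>"
    unfolding phase_diff_def path_diff_def by (intro continuous_intros assms(1)) auto
  then have "(?f \<longlongrightarrow> ?f \<xi>) (nhds \<xi>)"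
    using tendsto_at_iff_tendsto_nhds[of ?f \<xi>] by (simp only: isCont_def)
  then have "eventually (\<lambda>x. \<lfloor>?f x\<rfloor> = \<lfloor>?f \<xi>\<rfloor>) (nhds \<xi>)"
    by (rule eventually_floor_eq) (use assms(2) in auto)
  then show ?thesis
    by eventually_elim (simp add: obs_def obs_branch_def rmod_def)
qed

lemma score_eq_deriv_ln_likelihood:
  assumes "isCont c \<xi>" and "\<And>n. n < N \<Longrightarrow> phase_diff wl r q n (c \<xi>) / (2 * pi) \<notin> \<int>"
  shows "score N wl \<sigma> r q c \<xi> z = deriv (\<lambda>x. ln (likelihood N wl \<sigma> r q (c x) z)) \<xi>"
proof -
  have "eventually (\<lambda>x. \<forall>n\<in>{..<N}. obs wl r q n (c x) = obs_branch wl r q (c \<xi>) n (c x)) (nhds \<xi>)"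
    by (intro eventually_ball_finite ballI obs_eq_obs_branch) (use assms in auto)
  then have "eventually (\<lambda>x. ln (iso_normal_density N (\<lambda>n. obs_branch wl r q (c \<xi>) n (c x)) \<sigma> z) =
      ln (likelihood N wl \<sigma> r q (c x) z)) (nhds \<xi>)"
    by eventually_elim (simp add: likelihood_def iso_normal_density_def)
  then show ?thesis
    unfolding score_def by (intro deriv_cong_ev refl)
qed

end

theory Submission
  imports Defs
begin

text \<open>
  Since every derivative is that of a branch with the increments of the unwrapped phase, the score
  at the true parameter is the linear form \<open>(\<Sum>n<N. a n * e n) / \<sigma>\<^sup>2\<close> in the noise \<open>e\<close>, where \<open>a n\<close>
  is the derivative of the \<open>n\<close>th phase difference. As the noise is uncorrelated with variance
  \<open>\<sigma>\<^sup>2\<close>, the Fisher information is \<open>(\<Sum>n<N. (a n)\<^sup>2) / \<sigma>\<^sup>2\<close>. By the law of cosines the distances to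
  the antennas are \<open>sqrt (d\<^sup>2 + (D / 2)\<^sup>2 - d * D * g n)\<close>; the angular derivatives of \<open>g n\<close> are the
  cosines and sines of the \<open>N\<close> equally spaced elevations, whose squares sum to \<open>N / 2\<close> for \<open>N \<ge> 3\<close>.
\<close>

section \<open>Moments of isotropic Gaussian noise\<close>

lemma iso_normal_density_eq_prod:
  assumes "\<sigma> > 0"
  shows "iso_normal_density N \<mu> \<sigma> z = (\<Prod>n<N. normal_density (\<mu> n) \<sigma> (z n))"
  by (simp add: iso_normal_density_def normal_density_def prod.distrib prod_dividef
      real_sqrt_power exp_sum [symmetric] sum_negf sum_divide_distrib)

text \<open>The integrand factors over the coordinates, so by Fubini its integral is a product of
  one-dimensional Gaussian moments. For \<open>i \<noteq> j\<close> a vanishing first moment occurs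
  among them; for \<open>i = j\<close> they are one variance and total masses 1.\<close>

lemma
  assumes "\<sigma> > 0" "i < N" "j < N"
  shows iso_normal_second_moment:
      "(\<integral>e. iso_normal_density N (\<lambda>n. 0) \<sigma> e * (e i * e j) \<partial>(\<Pi>\<^sub>M n\<in>{..<N}. lborel)) =
        (if i = j then \<sigma>\<^sup>2 else 0)" (is "?I = _")
    and integrable_iso_normal_second_moment:
      "integrable (\<Pi>\<^sub>M n\<in>{..<N}. lborel)
        (\<lambda>e. iso_normal_density N (\<lambda>n. 0) \<sigma> e * (e i * e j))" (is "integrable ?M ?f")
proof -
  interpret product_sigma_finite "\<lambda>_::nat. lborel :: real measure" ..
  \<comment> \<open>\<open>k n\<close> is the exponent of coordinate \<open>n\<close> in the
    monomial \<open>e i * e j\<close>: 2 for \<open>n = i = j\<close>, and 0 or 1 when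
    \<open>i \<noteq> j\<close>.\<close>
  define k where "k n = of_bool (n = i) + (of_bool (n = j) :: nat)" for n
  define g where "g n x = normal_density 0 \<sigma> x * x ^ k n" for n x
  have "x ^ of_bool b = (if b then x else 1)" for x :: real and b
    by simp
  then have f_eq: "?f = (\<lambda>e. \<Prod>n<N. g n (e n))"
    using assms by (simp add: iso_normal_density_eq_prod g_def k_def prod.distrib power_add)
  have int_g: "integrable lborel (g n)" for n
    using integrable_normal_moment [OF assms(1), of 0 "k n"] by (simp add: g_def [abs_def])
  have "?I = (\<Prod>n<N. \<integral>x. g n x \<partial>lborel)"
    unfolding f_eq by (rule product_integral_prod) (use int_g in auto)
  also have "\<dots> = (if i = j then \<sigma>\<^sup>2 else 0)"
  proof (cases "i = j")
    case True
    have "(\<integral>x. g n x \<partial>lborel) = (if n = i then \<sigma>\<^sup>2 else 1)" for n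
      using True integral_normal_moment_even [OF assms(1), of 0 1] assms(1)
      by (simp add: g_def k_def fact_numeral numeral_2_eq_2 [symmetric])
    with True assms show ?thesis by simp
  next
    case False
    have "(\<integral>x. g i x \<partial>lborel) = 0"
      using False integral_normal_moment_odd [OF assms(1), of 0 0] by (simp add: g_def k_def)
    with assms have "(\<Prod>n<N. \<integral>x. g n x \<partial>lborel) = 0"
      by (intro prod_zero) auto
    with False show ?thesis by simp
  qed
  finally show "?I = (if i = j then \<sigma>\<^sup>2 else 0)" .
  show "integrable ?M ?f"
    unfolding f_eq by (rule product_integrable_prod) (use int_g in auto)
qed

text \<open>Expanding the square gives a double sum of second moments, of which only the diagonal
  survives.\<close>

lemma expectation_linear_form_squared:
  assumes "\<sigma> > 0"
    and "distributed M (\<Pi>\<^sub>M n\<in>{..<N}. lborel) \<eta>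
           (\<lambda>e. ennreal (iso_normal_density N (\<lambda>n. 0) \<sigma> e))"
  shows "(\<integral>\<omega>. (\<Sum>n<N. a n * \<eta> \<omega> n)\<^sup>2 \<partial>M) = \<sigma>\<^sup>2 * (\<Sum>n<N. (a n)\<^sup>2)"
proof -
  let ?P = "\<Pi>\<^sub>M n\<in>{..<N}. lborel :: real measure"
  let ?p = "iso_normal_density N (\<lambda>n. 0) \<sigma>"
  have "(\<integral>\<omega>. (\<Sum>n<N. a n * \<eta> \<omega> n)\<^sup>2 \<partial>M) = (\<integral>e. ?p e * (\<Sum>n<N. a n * e n)\<^sup>2 \<partial>?P)"
    by (rule distributed_integral [OF assms(2), symmetric])
      (auto simp: iso_normal_density_eq_prod [OF assms(1)] intro!: prod_nonneg)
  also have "\<dots> = (\<integral>e. (\<Sum>i<N. \<Sum>j<N. a i * a j * (?p e * (e i * e j))) \<partial>?P)"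
    by (simp add: power2_eq_square sum_product sum_distrib_left mult_ac)
  also have "\<dots> = (\<Sum>i<N. \<Sum>j<N. a i * a j * (\<integral>e. ?p e * (e i * e j) \<partial>?P))"
  proof -
    have int: "integrable ?P (\<lambda>e. a i * a j * (?p e * (e i * e j)))" if "i < N" "j < N" for i j
      by (intro integrable_mult_right integrable_iso_normal_second_moment assms(1) that)
    have "(\<integral>e. (\<Sum>i<N. \<Sum>j<N. a i * a j * (?p e * (e i * e j))) \<partial>?P) =
        (\<Sum>i<N. \<integral>e. (\<Sum>j<N. a i * a j * (?p e * (e i * e j))) \<partial>?P)"
      by (intro Bochner_Integration.integral_sum Bochner_Integration.integrable_sum int) auto
    also have "\<dots> = (\<Sum>i<N. \<Sum>j<N. \<integral>e. a i * a j * (?p e * (e i * e j)) \<partial>?P)"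
      by (intro sum.cong refl Bochner_Integration.integral_sum int) auto
    finally show ?thesis by simp
  qed
  also have "\<dots> = (\<Sum>i<N. \<Sum>j<N. if i = j then \<sigma>\<^sup>2 * (a i)\<^sup>2 else 0)"
    by (intro sum.cong refl)
      (simp add: iso_normal_second_moment [OF assms(1)] power2_eq_square)
  also have "\<dots> = \<sigma>\<^sup>2 * (\<Sum>n<N. (a n)\<^sup>2)"
    by (simp add: sum_distrib_left)
  finally show ?thesis .
qed

section \<open>Score and Fisher information\<close>

text \<open>The value \<open>obs\<close> at the true position occurs both in the measurement and in
  the branch and cancels, so the residual is the noise minus an increment of the unwrapped
  phase.\<close>

lemma score_measurement:
  assumes "\<sigma> > 0"
    and "\<And>n. n < N \<Longrightarrow> ((\<lambda>x. phase_diff wl r q n (c x)) has_real_derivative a n) (at \<xi>)"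
  shows "score N wl \<sigma> r q c \<xi> (measurement N wl r q (c \<xi>) e) = (\<Sum>n<N. a n * e n) / \<sigma>\<^sup>2"
proof -
  define \<Delta> where "\<Delta> n x = phase_diff wl r q n (c x) - phase_diff wl r q n (c \<xi>)" for n x
  define K where "K = 1 / sqrt ((2 * pi * \<sigma>\<^sup>2) ^ N)"
  have "K > 0" using assms(1) by (simp add: K_def)
  then have ln_density: "ln (iso_normal_density N (\<lambda>n. obs_branch wl r q (c \<xi>) n (c x)) \<sigma>
        (measurement N wl r q (c \<xi>) e)) =
      ln K - (\<Sum>n<N. (e n - \<Delta> n x)\<^sup>2) / (2 * \<sigma>\<^sup>2)" for x
  proof -
    have "(\<Sum>n<N. (measurement N wl r q (c \<xi>) e n - obs_branch wl r q (c \<xi>) n (c x))\<^sup>2) =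
        (\<Sum>n<N. (e n - \<Delta> n x)\<^sup>2)"
      by (intro sum.cong refl) (simp add: measurement_def obs_branch_def \<Delta>_def)
    then show ?thesis
      using \<open>K > 0\<close> unfolding iso_normal_density_def K_def [symmetric] by (simp add: ln_mult)
  qed
  \<comment> \<open>Since \<open>\<Delta> n \<xi> = 0\<close>, the inner factor is just
    \<open>e n\<close> at the true parameter, which makes the score linear in the noise.\<close>
  have "((\<lambda>x. (e n - \<Delta> n x)\<^sup>2) has_real_derivative - (2 * (a n * e n))) (at \<xi>)" if "n < N" for n
    unfolding \<Delta>_def by (auto intro!: derivative_eq_intros assms(2) that)
  then have "((\<lambda>x. ln K - (\<Sum>n<N. (e n - \<Delta> n x)\<^sup>2) / (2 * \<sigma>\<^sup>2)) has_real_derivative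
      0 - (\<Sum>n<N. - (2 * (a n * e n))) / (2 * \<sigma>\<^sup>2)) (at \<xi>)"
    by (intro DERIV_diff DERIV_const DERIV_cdivide DERIV_sum) auto
  also have "0 - (\<Sum>n<N. - (2 * (a n * e n))) / (2 * \<sigma>\<^sup>2) = (\<Sum>n<N. a n * e n) / \<sigma>\<^sup>2"
    by (simp add: sum_negf sum_distrib_left [symmetric])
  finally show ?thesis
    unfolding score_def ln_density by (rule DERIV_imp_deriv)
qed

lemma fisher_info_eq:
  assumes "\<sigma> > 0"
    and "\<And>n. n < N \<Longrightarrow> ((\<lambda>x. phase_diff wl r q n (c x)) has_real_derivative a n) (at \<xi>)"
    and "distributed M (\<Pi>\<^sub>M n\<in>{..<N}. lborel) \<eta>
           (\<lambda>e. ennreal (iso_normal_density N (\<lambda>n. 0) \<sigma> e))"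
  shows "fisher_info M \<eta> N wl \<sigma> r q c \<xi> = (\<Sum>n<N. (a n)\<^sup>2) / \<sigma>\<^sup>2"
proof -
  have "fisher_info M \<eta> N wl \<sigma> r q c \<xi> = (\<integral>\<omega>. (\<Sum>n<N. a n * \<eta> \<omega> n)\<^sup>2 \<partial>M) / (\<sigma>\<^sup>2)\<^sup>2"
    by (simp add: fisher_info_def score_measurement [OF assms(1,2)] power_divide)
  also have "\<dots> = (\<Sum>n<N. (a n)\<^sup>2) / \<sigma>\<^sup>2"
    unfolding expectation_linear_form_squared [OF assms(1,3)]
    using assms(1) by (simp add: power2_eq_square)
  finally show ?thesis .
qed

section \<open>The circular array\<close>

lemma norm_spherical_point_diff:
  "norm (spherical_point r \<rho> \<theta> \<phi> - spherical_point r \<rho>' \<theta>' \<phi>') =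
     sqrt (\<rho>\<^sup>2 + \<rho>'\<^sup>2 - 2 * \<rho> * \<rho>' * (sin \<theta>' * sin \<theta> * cos (\<phi>' - \<phi>) + cos \<theta>' * cos \<theta>))"
proof -
  \<comment> \<open>Keeping the sums sin^2 + cos^2 unevaluated makes this a polynomial identity in
    the sines and cosines; they are simplified to 1 afterwards.\<close>
  have "(\<rho> * (cos \<phi> * sin \<theta>) - \<rho>' * (cos \<phi>' * sin \<theta>'))\<^sup>2 +
      (\<rho> * (sin \<phi> * sin \<theta>) - \<rho>' * (sin \<phi>' * sin \<theta>'))\<^sup>2 + (\<rho> * cos \<theta> - \<rho>' * cos \<theta>')\<^sup>2 =
    \<rho>\<^sup>2 * (((sin \<phi>)\<^sup>2 + (cos \<phi>)\<^sup>2) * (sin \<theta>)\<^sup>2 + (cos \<theta>)\<^sup>2) +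
      \<rho>'\<^sup>2 * (((sin \<phi>')\<^sup>2 + (cos \<phi>')\<^sup>2) * (sin \<theta>')\<^sup>2 + (cos \<theta>')\<^sup>2) -
      2 * \<rho> * \<rho>' * (sin \<theta>' * sin \<theta> * (cos \<phi>' * cos \<phi> + sin \<phi>' * sin \<phi>) + cos \<theta>' * cos \<theta>)"
    by algebra
  then show ?thesis
    by (simp add: norm_eq_sqrt_inner inner_vec_def sum_3 spherical_point_def cos_diff
        power2_eq_square [symmetric])
qed

text \<open>The reference location is the spherical point of radius 0.\<close>

lemma norm_spherical_point_diff_center: "norm (spherical_point r \<rho> \<theta> \<phi> - r) = \<bar>\<rho>\<bar>"
  using norm_spherical_point_diff [of r \<rho> \<theta> \<phi> 0 0 0] by (simp add: spherical_point_def)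

text \<open>The sum is the real part of a geometric sum of powers of an \<open>N\<close>th root of
  unity \<open>w\<close>, which vanishes once \<open>w \<noteq> 1\<close>. This is where
  \<open>N \<ge> 3\<close> enters: \<open>w\<close> would be 1 for \<open>N = 1\<close> and
  \<open>N = 2\<close>.\<close>

lemma sum_cos_double_equally_spaced:
  assumes "N \<ge> 3"
  shows "(\<Sum>n<N. cos (2 * (2 * pi * real n / real N))) = 0"
proof -
  define w where "w = cis (2 * (2 * pi) / real N)"
  have w_pow: "w ^ n = cis (2 * (2 * pi * real n / real N))" for n
    by (simp add: w_def Complex.DeMoivre field_simps)
  have "w \<noteq> 1"
  proof
    assume "w = 1"
    then have "cos (2 * (2 * pi / real N)) = 1"
      by (simp add: w_def complex_eq_iff)
    then have "sin (2 * pi / real N) = 0"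
      unfolding cos_double_sin by simp
    \<comment> \<open>For \<open>N \<ge> 3\<close> the angle lies strictly between 0 and
      \<pi>.\<close>
    moreover have "sin (2 * pi / real N) > 0"
      using assms by (intro sin_gt_zero) (auto simp: field_simps)
    ultimately show False by simp
  qed
  moreover have "w ^ N = 1"
    using assms by (simp add: w_pow cis.ctr complex_eq_iff cos_double_sin sin_double)
  ultimately have "(\<Sum>n<N. w ^ n) = 0"
    by (simp add: geometric_sum)
  then have "Re (\<Sum>n<N. w ^ n) = 0" by simp
  then show ?thesis by (simp add: w_pow)
qed

text \<open>By the half-angle formulas each square is 1/2 plus or minus half the cosine of the
  doubled angle, and those cosines sum to 0.\<close>

lemma
  assumes "N \<ge> 3"
  shows sum_cos_squared_equally_spaced:
      "(\<Sum>n<N. (cos (2 * pi * real n / real N))\<^sup>2) = real N / 2" (is ?C)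
    and sum_sin_squared_equally_spaced:
      "(\<Sum>n<N. (sin (2 * pi * real n / real N))\<^sup>2) = real N / 2" (is ?S)
proof -
  let ?t = "\<lambda>n. 2 * pi * real n / real N"
  have "(\<Sum>n<N. (cos (?t n))\<^sup>2) = (\<Sum>n<N. 1 / 2 + cos (2 * ?t n) / 2)"
    by (intro sum.cong refl) (simp only: cos_double_cos, simp add: field_simps)
  also have "\<dots> = real N / 2"
    by (simp only: sum.distrib sum_divide_distrib [symmetric]
        sum_cos_double_equally_spaced [OF assms]) simp
  finally show ?C .
  have "(\<Sum>n<N. (sin (?t n))\<^sup>2) = (\<Sum>n<N. 1 / 2 - cos (2 * ?t n) / 2)"
    by (intro sum.cong refl) (simp only: cos_double_sin, simp add: field_simps)
  also have "\<dots> = real N / 2"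
    by (simp only: sum_subtractf sum_divide_distrib [symmetric]
        sum_cos_double_equally_spaced [OF assms]) simp
  finally show ?S .
qed

theorem proposition4:
  fixes wl \<sigma> D d :: real and N :: nat and r :: "real^3" and q :: "nat \<Rightarrow> real^3"
    and M :: "'a measure" and \<eta> :: "'a \<Rightarrow> nat \<Rightarrow> real"
  assumes "wl > 0" and "\<sigma> > 0" and "D > 0" and "N \<ge> 3" and "d > 0"
    and "\<And>n. n < N \<Longrightarrow> q n = spherical_point r (D / 2) (2 * pi * real n / real N) (pi / 2)"
    and "prob_space M"
    and "distributed M (\<Pi>\<^sub>M n\<in>{..<N}. lborel) \<eta>
           (\<lambda>e. ennreal (iso_normal_density N (\<lambda>n. 0) \<sigma> e))"
  shows "fisher_info M \<eta> N wl \<sigma> r q (\<lambda>x. spherical_point r x (pi / 2) 0) d =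
           4 * real N * pi\<^sup>2 / (wl\<^sup>2 * \<sigma>\<^sup>2) *
           ((2 + D\<^sup>2 / (4 * d\<^sup>2) - 2 * sqrt (1 + D\<^sup>2 / (4 * d\<^sup>2))) / (1 + D\<^sup>2 / (4 * d\<^sup>2))) \<and>
         fisher_info M \<eta> N wl \<sigma> r q (\<lambda>x. spherical_point r d x 0) (pi / 2) =
           real N * pi\<^sup>2 / (2 * wl\<^sup>2 * \<sigma>\<^sup>2) * (D\<^sup>2 / (1 + D\<^sup>2 / (4 * d\<^sup>2))) \<and>
         fisher_info M \<eta> N wl \<sigma> r q (\<lambda>x. spherical_point r d (pi / 2) x) 0 =
           real N * pi\<^sup>2 / (2 * wl\<^sup>2 * \<sigma>\<^sup>2) * (D\<^sup>2 / (1 + D\<^sup>2 / (4 * d\<^sup>2)))"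
proof -
  define t where "t n = 2 * pi * real n / real N" for n
  \<comment> \<open>\<open>R\<close> is the distance from the source to every antenna, as all
    \<open>g n\<close> vanish at its position.\<close>
  define R where "R = sqrt (d\<^sup>2 + (D / 2)\<^sup>2)"
  have R: "R > 0" "R\<^sup>2 = d\<^sup>2 + (D / 2)\<^sup>2"
    using \<open>d > 0\<close> by (simp_all add: R_def add_pos_nonneg)
  have u: "1 + D\<^sup>2 / (4 * d\<^sup>2) = R\<^sup>2 / d\<^sup>2"
    using \<open>d > 0\<close> by (simp add: R field_simps)
  have sqrt_u: "sqrt (1 + D\<^sup>2 / (4 * d\<^sup>2)) = R / d"
    using R(1) \<open>d > 0\<close> by (simp add: u real_sqrt_divide)
  have angular: "D\<^sup>2 / (1 + D\<^sup>2 / (4 * d\<^sup>2)) = D\<^sup>2 * d\<^sup>2 / R\<^sup>2"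
    by (simp add: u)
  \<comment> \<open>The antenna azimuth \<pi>/2 turns the cosine of the azimuth difference into
    \<open>sin \<phi>\<close>.\<close>
  have phase: "phase_diff wl r q n (spherical_point r x \<theta> \<phi>) = 2 * pi / wl *
      (sqrt (x\<^sup>2 + (D / 2)\<^sup>2 - x * D * (sin (t n) * sin \<theta> * sin \<phi> + cos (t n) * cos \<theta>)) - \<bar>x\<bar>)"
    if "n < N" for n x \<theta> \<phi>
    using assms(6) [OF that]
    by (simp add: phase_diff_def path_diff_def norm_spherical_point_diff t_def
        norm_spherical_point_diff_center cos_diff)
  \<comment> \<open>The numerator on the right is the square of \<open>R / d - 1\<close>, and the
    denominator is the square of \<open>R / d\<close>.\<close>
  have radial: "(d / R - 1)\<^sup>2 = (2 + D\<^sup>2 / (4 * d\<^sup>2) - 2 * sqrt (1 + D\<^sup>2 / (4 * d\<^sup>2))) /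
      (1 + D\<^sup>2 / (4 * d\<^sup>2))"
  proof -
    have numerator: "2 + D\<^sup>2 / (4 * d\<^sup>2) - 2 * sqrt (1 + D\<^sup>2 / (4 * d\<^sup>2)) = 1 + R\<^sup>2 / d\<^sup>2 - 2 * (R / d)"
      using u sqrt_u by simp
    show ?thesis
      unfolding numerator unfolding u using R(1) \<open>d > 0\<close> by (simp add: field_simps power2_eq_square)
  qed
  have sum_cos_squared: "(\<Sum>n<N. (cos (t n))\<^sup>2) = real N / 2"
    and sum_sin_squared: "(\<Sum>n<N. (sin (t n))\<^sup>2) = real N / 2"
    unfolding t_def using \<open>N \<ge> 3\<close>
    by (rule sum_cos_squared_equally_spaced sum_sin_squared_equally_spaced)+
  note info = fisher_info_eq [OF \<open>\<sigma> > 0\<close> _ assms(8)]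

  \<comment> \<open>One chain rule serves all three coordinates: \<open>f\<close> is the squared
    distance to an antenna, \<open>g\<close> the distance to the reference location.\<close>
  have deriv_phase: "((\<lambda>x. 2 * pi / wl * (sqrt (f x) - g x)) has_real_derivative
      2 * pi / wl * (f' / (2 * R) - g')) (at \<xi>)"
    if "(f has_real_derivative f') (at \<xi>)" "(g has_real_derivative g') (at \<xi>)" "f \<xi> = R\<^sup>2"
    for f g f' g' \<xi>
    using that R(1) \<open>wl > 0\<close> by (auto intro!: derivative_eq_intros simp: field_simps)

  \<comment> \<open>Near \<open>d > 0\<close> the absolute value is the identity.\<close>
  have deriv_abs: "(abs has_real_derivative 1) (at d)"
    using \<open>d > 0\<close>
    by (intro has_field_derivative_transform_within_open [OF DERIV_ident open_greaterThan]) auto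
  \<comment> \<open>Along the x-axis \<open>g n\<close> stays 0, so only \<open>x\<^sup>2\<close>
    varies under the root and the derivative is the same for all antennas.\<close>
  have "((\<lambda>x. phase_diff wl r q n (spherical_point r x (pi / 2) 0)) has_real_derivative
      2 * pi / wl * (d / R - 1)) (at d)" if "n < N" for n
    unfolding phase [OF that] using deriv_abs R
    by (intro DERIV_cong [OF deriv_phase [where f' = "2 * d" and g' = 1]])
      (auto intro!: derivative_eq_intros)
  then have "fisher_info M \<eta> N wl \<sigma> r q (\<lambda>x. spherical_point r x (pi / 2) 0) d =
      (\<Sum>n<N. (2 * pi / wl * (d / R - 1))\<^sup>2) / \<sigma>\<^sup>2"
    by (rule info)
  also have "\<dots> = 4 * real N * pi\<^sup>2 / (wl\<^sup>2 * \<sigma>\<^sup>2) * (d / R - 1)\<^sup>2"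
    by (simp add: power_mult_distrib power_divide)
  also have "\<dots> = 4 * real N * pi\<^sup>2 / (wl\<^sup>2 * \<sigma>\<^sup>2) *
      ((2 + D\<^sup>2 / (4 * d\<^sup>2) - 2 * sqrt (1 + D\<^sup>2 / (4 * d\<^sup>2))) / (1 + D\<^sup>2 / (4 * d\<^sup>2)))"
    by (simp only: radial)
  finally have range: "fisher_info M \<eta> N wl \<sigma> r q (\<lambda>x. spherical_point r x (pi / 2) 0) d = \<dots>" .

  \<comment> \<open>The elevation derivative of \<open>g n\<close> is \<open>- cos (t n)\<close>
    here; the distance to the reference location is constant, hence \<open>g' = 0\<close>.\<close>
  have "((\<lambda>x. phase_diff wl r q n (spherical_point r d x 0)) has_real_derivative
      pi * d * D / (wl * R) * cos (t n)) (at (pi / 2))" if "n < N" for n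
    unfolding phase [OF that] using R
    by (intro DERIV_cong [OF deriv_phase [where f' = "d * D * cos (t n)" and g' = 0]])
      (auto intro!: derivative_eq_intros)
  then have "fisher_info M \<eta> N wl \<sigma> r q (\<lambda>x. spherical_point r d x 0) (pi / 2) =
      (\<Sum>n<N. (pi * d * D / (wl * R) * cos (t n))\<^sup>2) / \<sigma>\<^sup>2"
    by (rule info)
  also have "\<dots> = real N * pi\<^sup>2 / (2 * wl\<^sup>2 * \<sigma>\<^sup>2) * (D\<^sup>2 * d\<^sup>2 / R\<^sup>2)"
    by (simp only: power_mult_distrib sum_distrib_left [symmetric] sum_cos_squared)
      (simp add: power_mult_distrib power_divide mult_ac)
  finally have elevation: "fisher_info M \<eta> N wl \<sigma> r q (\<lambda>x. spherical_point r d x 0) (pi / 2) = \<dots>" .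

  \<comment> \<open>The azimuth derivative of \<open>g n\<close> is \<open>sin (t n)\<close>, so the
    same computation applies with sines.\<close>
  have "((\<lambda>x. phase_diff wl r q n (spherical_point r d (pi / 2) x)) has_real_derivative
      - (pi * d * D / (wl * R)) * sin (t n)) (at 0)" if "n < N" for n
    unfolding phase [OF that] using R
    by (intro DERIV_cong [OF deriv_phase [where f' = "- (d * D * sin (t n))" and g' = 0]])
      (auto intro!: derivative_eq_intros)
  then have "fisher_info M \<eta> N wl \<sigma> r q (\<lambda>x. spherical_point r d (pi / 2) x) 0 =
      (\<Sum>n<N. (- (pi * d * D / (wl * R)) * sin (t n))\<^sup>2) / \<sigma>\<^sup>2"
    by (rule info)
  also have "\<dots> = real N * pi\<^sup>2 / (2 * wl\<^sup>2 * \<sigma>\<^sup>2) * (D\<^sup>2 * d\<^sup>2 / R\<^sup>2)"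
    by (simp only: power_mult_distrib sum_distrib_left [symmetric] sum_sin_squared)
      (simp add: power_mult_distrib power_divide mult_ac)
  finally have azimuth: "fisher_info M \<eta> N wl \<sigma> r q (\<lambda>x. spherical_point r d (pi / 2) x) 0 = \<dots>" .

  show ?thesis
    unfolding angular using range elevation azimuth by blast
qed

end
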